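(* Let $S$ be a set and let $\vdash$ be a monotone cut-idempotent relation on $\mathsf{F}S$. Then the quasi-ideals $\mathsf{Q}S$, ordered by inclusion, form an arithmetic lattice such that, for all $\mathcal{P},\mathcal{Q}\in\mathsf{Q}S$, \[\mathcal{P}\ll\mathcal{Q}\quad\Leftrightarrow\quad\exists\mathcal{G}\in\mathsf{F}\mathcal{Q}\ \ \forall F\in\mathcal{P}\ \forall H\in\mathcal{G}_\between\ (F\vdash H).\] Moreover, $\vdash$ is divisible (and thus a strong idempotent) precisely when, for all $G\in\mathsf{F}S$, \[G^\dashv=\bigvee_{g\in G}g^\dashv .\] In this case (i.e. when $\vdash$ is divisible), $\mathsf{Q}S$ is generated by the principal quasi-ideals $(s^\dashv)_{s\in S}$ and, for all $F,G\in\mathsf{F}S$, \[F\Vdash G\quad\Leftrightarrow\quad\bigwedge_{f\in F}f^\dashv\subseteq\bigvee_{g\in G}g^\dashv ;\] also, $\vdash$ is then auxiliary to $\Vdash$ (and thus a cover relation) precisely when, for all $F,G\in\mathsf{F}S$, \[F\vdash G\quad\Leftrightarrow\quad\bigwedge_{f\in F}f^\dashv\ll\bigvee_{g\in G}g^\dashv .\]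
   Context: $\mathsf{F}A$ is the set of finite subsets of a set $A$ (including $\emptyset$). For $\mathcal{F}\subseteq\mathsf{F}S$, $\mathcal{F}_\between=\{G\in\mathsf{F}S: G\cap F\neq\emptyset\text{ for all }F\in\mathcal{F}\}$. For $\mathcal{F},\mathcal{G}\in\mathsf{F}\mathsf{F}S$, $\mathcal{F}\bowtie\mathcal{G}$ means every element of $\mathcal{F}_\between$ contains some element of $\mathcal{G}$ as a subset. For relations $\vdash,\vDash$ on $\mathsf{F}S$: $F\vdash\bullet\vDash G$ iff there are $\mathcal{F},\mathcal{G}\in\mathsf{F}\mathsf{F}S$ with $\mathcal{F}\bowtie\mathcal{G}$, $F\vdash F'$ for all $F'\in\mathcal{F}$ and $G'\vDash G$ for all $G'\in\mathcal{G}$. $F\vdash_{1\exists}G$ iff $F\vdash\{g\}$ for some $g\in G$. $\vdash$ is monotone if $F\vdash G$, $F\subseteq F'$, $G\subseteq G'$ imply $F'\vdash G'$; cut-idempotent if $\vdash\ =\ \vdash\bullet\vdash$; divisible if $\vdash\ \subseteq\ \vdash\bullet\vdash_{1\exists}$. A strong idempotent is a monotone divisible $\vdash$ with $\vdash\bullet\vdash\ \subseteq\ \vdash$. $\mathsf{B}S=\{F\in\mathsf{F}S:\exists G\in\mathsf{F}S\ (F\vdash G)\}$. $F\Vdash G$ iff for all $H\in\mathsf{B}S$, if $H\vdash\{f\}$ for all $f\in F$ then $H\vdash G$. $\vdash$ is auxiliary to $\Vdash$ if for all $F,G,H\in\mathsf{F}S$: $F\Vdash H$ and $\{h\}\cup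 F\vdash G$ for all $h\in H$ imply $F\vdash G$. A cover relation is a strong idempotent auxiliary to $\Vdash$. A quasi-ideal is a $\mathcal{Q}\subseteq\mathsf{B}S$ such that, for all $F\in\mathsf{B}S$: $F\in\mathcal{Q}$ iff there is $\mathcal{G}\in\mathsf{F}\mathcal{Q}$ with $F\vdash G$ for all $G\in\mathcal{G}_\between$. For $G\in\mathsf{F}S$, $G^\dashv=\{F\in\mathsf{F}S:F\vdash G\}$, and $g^\dashv=\{g\}^\dashv$ for $g\in S$; these are quasi-ideals. $\bigvee,\bigwedge$ are joins and meets in $\mathsf{Q}S$ (empty meet $=$ top $=\mathsf{B}S$, empty join $=$ bottom), and $\ll$ is the way-below relation of $\mathsf{Q}S$. An arithmetic lattice is a continuous lattice in which finite meets distribute over arbitrary joins and in which $p\ll q$ and $p\ll r$ imply $p\ll q\wedge r$. A subset $A$ of a frame $L$ generates $L$ if every element of $L$ is a (possibly infinite) join of meets of finite subsets of $A$. *)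

theory Defs
  imports "HOL-Algebra.Complete_Lattice"
begin

section \<open>Way-below, continuous and arithmetic lattices, generation\<close>

definition directed_in :: "('a, 'b) gorder_scheme \<Rightarrow> 'a set \<Rightarrow> bool"
  where "directed_in L D \<longleftrightarrow>
    D \<subseteq> carrier L \<and> D \<noteq> {} \<and> (\<forall>x\<in>D. \<forall>y\<in>D. \<exists>z\<in>D. x \<sqsubseteq>\<^bsub>L\<^esub> z \<and> y \<sqsubseteq>\<^bsub>L\<^esub> z)"

definition way_below :: "('a, 'b) gorder_scheme \<Rightarrow> 'a \<Rightarrow> 'a \<Rightarrow> bool"
  where "way_below L p q \<longleftrightarrow> p \<in> carrier L \<and> q \<in> carrier L \<and>
    (\<forall>D. directed_in L D \<longrightarrow> q \<sqsubseteq>\<^bsub>L\<^esub> \<Squnion>\<^bsub>L\<^esub>D \<longrightarrow> (\<exists>d\<in>D. p \<sqsubseteq>\<^bsub>L\<^esub> d))"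

text \<open>In a complete lattice the elements way below a given one are automatically directed,
  so approximation by all of them is the usual notion of continuity.\<close>

locale continuous_lattice = complete_lattice +
  assumes approximation:
    "p \<in> carrier L \<Longrightarrow> p = \<Squnion>\<^bsub>L\<^esub>{q \<in> carrier L. way_below L q p}"

text \<open>Nullary meets distribute over joins trivially, so finite distributivity amounts to the
  binary case.\<close>

locale arithmetic_lattice = continuous_lattice +
  assumes meet_distrib_Sup:
    "\<lbrakk>p \<in> carrier L; A \<subseteq> carrier L\<rbrakk> \<Longrightarrow> p \<sqinter>\<^bsub>L\<^esub> (\<Squnion>\<^bsub>L\<^esub>A) = \<Squnion>\<^bsub>L\<^esub>((\<lambda>a. p \<sqinter>\<^bsub>L\<^esub> a) ` A)"
  and way_below_meet:
    "\<lbrakk>way_below L p q; way_below L p r\<rbrakk> \<Longrightarrow> way_below L p (q \<sqinter>\<^bsub>L\<^esub> r)"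

definition generates :: "('a, 'b) gorder_scheme \<Rightarrow> 'a set \<Rightarrow> bool"
  where "generates L A \<longleftrightarrow> A \<subseteq> carrier L \<and>
    (\<forall>x\<in>carrier L. \<exists>M \<subseteq> {\<Sqinter>\<^bsub>L\<^esub>B |B. B \<in> Fpow A}. x = \<Squnion>\<^bsub>L\<^esub>M)"


section \<open>Relations on finite subsets\<close>

text \<open>Relations on the finite subsets \<^term>\<open>Fpow S\<close> of \<^term>\<open>S\<close> are sets of pairs contained
  in \<^term>\<open>Fpow S \<times> Fpow S\<close>.\<close>

definition cross_sets :: "'a set \<Rightarrow> 'a set set \<Rightarrow> 'a set set"
  where "cross_sets S \<F> = {G \<in> Fpow S. \<forall>F\<in>\<F>. G \<inter> F \<noteq> {}}"

definition bowtie :: "'a set \<Rightarrow> 'a set set \<Rightarrow> 'a set set \<Rightarrow> bool"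
  where "bowtie S \<F> \<G> \<longleftrightarrow> (\<forall>H\<in>cross_sets S \<F>. \<exists>G\<in>\<G>. G \<subseteq> H)"

definition cut_comp :: "'a set \<Rightarrow> ('a set \<times> 'a set) set \<Rightarrow> ('a set \<times> 'a set) set \<Rightarrow> ('a set \<times> 'a set) set"
  where "cut_comp S R T = {(F, G). F \<in> Fpow S \<and> G \<in> Fpow S \<and>
    (\<exists>\<F>\<in>Fpow (Fpow S). \<exists>\<G>\<in>Fpow (Fpow S). bowtie S \<F> \<G> \<and>
      (\<forall>F'\<in>\<F>. (F, F') \<in> R) \<and> (\<forall>G'\<in>\<G>. (G', G) \<in> T))}"

definition single_rel :: "'a set \<Rightarrow> ('a set \<times> 'a set) set \<Rightarrow> ('a set \<times> 'a set) set"
  where "single_rel S R = {(F, G). F \<in> Fpow S \<and> G \<in> Fpow S \<and> (\<exists>g\<in>G. (F, {g}) \<in> R)}"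

definition monotone_rel :: "'a set \<Rightarrow> ('a set \<times> 'a set) set \<Rightarrow> bool"
  where "monotone_rel S R \<longleftrightarrow> (\<forall>F\<in>Fpow S. \<forall>G\<in>Fpow S. \<forall>F'\<in>Fpow S. \<forall>G'\<in>Fpow S.
    (F, G) \<in> R \<longrightarrow> F \<subseteq> F' \<longrightarrow> G \<subseteq> G' \<longrightarrow> (F', G') \<in> R)"

definition cut_idempotent :: "'a set \<Rightarrow> ('a set \<times> 'a set) set \<Rightarrow> bool"
  where "cut_idempotent S R \<longleftrightarrow> R = cut_comp S R R"

definition divisible :: "'a set \<Rightarrow> ('a set \<times> 'a set) set \<Rightarrow> bool"
  where "divisible S R \<longleftrightarrow> R \<subseteq> cut_comp S R (single_rel S R)"

definition strong_idempotent :: "'a set \<Rightarrow> ('a set \<times> 'a set) set \<Rightarrow> bool"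
  where "strong_idempotent S R \<longleftrightarrow> monotone_rel S R \<and> divisible S R \<and> cut_comp S R R \<subseteq> R"

definition bounded_sets :: "'a set \<Rightarrow> ('a set \<times> 'a set) set \<Rightarrow> 'a set set"
  where "bounded_sets S R = {F \<in> Fpow S. \<exists>G\<in>Fpow S. (F, G) \<in> R}"

definition forcing :: "'a set \<Rightarrow> ('a set \<times> 'a set) set \<Rightarrow> ('a set \<times> 'a set) set"
  where "forcing S R = {(F, G). F \<in> Fpow S \<and> G \<in> Fpow S \<and>
    (\<forall>H\<in>bounded_sets S R. (\<forall>f\<in>F. (H, {f}) \<in> R) \<longrightarrow> (H, G) \<in> R)}"

definition auxiliary_to :: "'a set \<Rightarrow> ('a set \<times> 'a set) set \<Rightarrow> ('a set \<times> 'a set) set \<Rightarrow> bool"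
  where "auxiliary_to S R T \<longleftrightarrow> (\<forall>F\<in>Fpow S. \<forall>G\<in>Fpow S. \<forall>H\<in>Fpow S.
    (F, H) \<in> T \<longrightarrow> (\<forall>h\<in>H. ({h} \<union> F, G) \<in> R) \<longrightarrow> (F, G) \<in> R)"

definition cover_relation :: "'a set \<Rightarrow> ('a set \<times> 'a set) set \<Rightarrow> bool"
  where "cover_relation S R \<longleftrightarrow> strong_idempotent S R \<and> auxiliary_to S R (forcing S R)"


section \<open>Quasi-ideals\<close>

definition quasi_ideal :: "'a set \<Rightarrow> ('a set \<times> 'a set) set \<Rightarrow> 'a set set \<Rightarrow> bool"
  where "quasi_ideal S R \<Q> \<longleftrightarrow> \<Q> \<subseteq> bounded_sets S R \<and>
    (\<forall>F\<in>bounded_sets S R.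
      F \<in> \<Q> \<longleftrightarrow> (\<exists>\<G>\<in>Fpow \<Q>. \<forall>G\<in>cross_sets S \<G>. (F, G) \<in> R))"

definition QI :: "'a set \<Rightarrow> ('a set \<times> 'a set) set \<Rightarrow> 'a set set gorder"
  where "QI S R = \<lparr>carrier = {\<Q>. quasi_ideal S R \<Q>}, eq = (=), le = (\<subseteq>)\<rparr>"

definition lower_of :: "'a set \<Rightarrow> ('a set \<times> 'a set) set \<Rightarrow> 'a set \<Rightarrow> 'a set set"
  where "lower_of S R G = {F \<in> Fpow S. (F, G) \<in> R}"

abbreviation principal_qi :: "'a set \<Rightarrow> ('a set \<times> 'a set) set \<Rightarrow> 'a \<Rightarrow> 'a set set"
  where "principal_qi S R g \<equiv> lower_of S R {g}"

end

theory Submission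
  imports Defs
begin

text \<open>
  Read a finite set on the left of the relation as the meet of its elements, a finite set on the
  right as the join of its elements, and a finite family \<open>\<G>\<close> of finite sets as a join of
  meets.  By distributivity such a join of meets is also the meet of the joins over all the sets
  in \<^term>\<open>cross_sets S \<G>\<close>, so that the relation extends to comparisons \<open>F \<turnstile> \<G>\<close> between a meet
  and a join of meets by \<open>F \<turnstile> \<G> \<longleftrightarrow> (\<forall>H\<in>cross_sets S \<G>. (F, H) \<in> R)\<close>.  This extension turns the
  syntax of bowties into order theory: cut-idempotence says exactly that \<open>\<turnstile>\<close> is transitive
  (lemma \<open>entails_trans\<close>) and interpolative (lemma \<open>entails_interpolate\<close>), and the
  distributive law takes the form that \<open>F \<turnstile> \<G>\<close> and \<open>F \<turnstile> \<H>\<close> give \<open>F \<turnstile> {G \<union> H}\<close>, with \<open>G\<close> and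
  \<open>H\<close> ranging over \<open>\<G>\<close> and \<open>\<H>\<close> (lemma \<open>entails_meet\<close>).

  Write \<open>rounding \<P>\<close> for the family of all \<open>F\<close> with \<open>F \<turnstile> \<G>\<close> for some finite \<open>\<G> \<subseteq> \<P>\<close>.
  Transitivity and interpolation make this operation idempotent, and the quasi-ideals are its
  fixed points.  Hence joins are roundings of unions, directed joins are plain unions, meets are
  roundings of intersections, and finite meets are plain intersections by the distributive law.
  Every quasi-ideal \<open>\<Q>\<close> is the directed union of \<open>rounding \<G>\<close> over the finite \<open>\<G> \<subseteq> \<Q>\<close>.
  This yields the description of the way-below relation, and with it continuity and the
  remaining laws of an arithmetic lattice.

  By interpolation on the right, divisibility says precisely that the sets below \<open>G\<close> are the
  rounding of the sets that are below a single element of \<open>G\<close>, which is the equation with the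
  join.  Applied to all crossing sets of a finite \<open>\<G> \<subseteq> \<Q>\<close> simultaneously, it shows that every
  \<open>F\<close> with \<open>F \<turnstile> \<G>\<close> belongs to a join of meets of principal quasi-ideals that are contained in \<open>\<Q>\<close>
  (lemma \<open>divisible_refine\<close>); so the principal quasi-ideals generate.  Since meets are
  intersections, the description of \<^term>\<open>forcing S R\<close> is then a reformulation of its definition.

  Finally, the description of the way-below relation turns \<open>\<And>F \<lless> \<Or>G\<close> into the existence of a
  finite family \<open>\<G>\<close> of sets below \<open>G\<close> with \<open>F\<close> forcing every set crossing \<open>\<G>\<close>.  If the relation
  is auxiliary to forcing, the forced sets inside \<open>\<Union>\<G>\<close>, of which there are finitely many, can be cut
  away one after the other.  Conversely, \<open>\<And>F \<lless> \<Or>G\<close>, as a relation between \<open>F\<close> and \<open>G\<close>, is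
  auxiliary to forcing by distributivity, since finite joins of elements way below \<open>\<Or>G\<close> are way
  below \<open>\<Or>G\<close>.
\<close>

section \<open>Crossing families and cuts\<close>

text \<open>Elements outside \<open>\<Union>\<G>\<close> do not help to cross \<open>\<G>\<close>, so for finite \<open>\<G>\<close> and a monotone
  relation, these finitely many crossing sets stand for all of \<^term>\<open>cross_sets S \<G>\<close>.\<close>

definition inner_cross :: "'a set \<Rightarrow> 'a set set \<Rightarrow> 'a set set"
  where "inner_cross S \<G> = {H \<in> cross_sets S \<G>. H \<subseteq> \<Union>\<G>}"

lemma finite_Union_Fpow: "\<G> \<in> Fpow (Fpow S) \<Longrightarrow> \<Union>\<G> \<in> Fpow S"
  unfolding Fpow_def by auto

lemma inner_cross_Fpow:
  assumes "\<G> \<in> Fpow (Fpow S)"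
  shows "inner_cross S \<G> \<in> Fpow (Fpow S)"
proof -
  have "inner_cross S \<G> \<subseteq> Pow (\<Union>\<G>)" unfolding inner_cross_def by blast
  moreover have "finite (\<Union>\<G>)" using finite_Union_Fpow[OF assms] by (simp add: Fpow_def)
  ultimately have "finite (inner_cross S \<G>)" by (meson finite_Pow_iff finite_subset)
  thus ?thesis unfolding inner_cross_def cross_sets_def Fpow_def by blast
qed

lemma cross_contains_inner_cross:
  assumes "\<G> \<in> Fpow (Fpow S)" "H \<in> cross_sets S \<G>"
  obtains K where "K \<in> inner_cross S \<G>" "K \<subseteq> H"
proof
  show "H \<inter> \<Union>\<G> \<in> inner_cross S \<G>"
    using assms unfolding inner_cross_def cross_sets_def Fpow_def by blast
qed simp

text \<open>The duality of disjunctive and conjunctive normal forms: the complement inside \<open>\<Union>\<G>\<close> of a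
  set containing no member of \<open>\<G>\<close> crosses \<open>\<G>\<close>.\<close>

lemma inner_cross_dual:
  assumes "\<G> \<in> Fpow (Fpow S)" "\<And>K. K \<in> inner_cross S \<G> \<Longrightarrow> A \<inter> K \<noteq> {}"
  shows "\<exists>G\<in>\<G>. G \<subseteq> A"
proof (rule ccontr)
  assume no: "\<not> (\<exists>G\<in>\<G>. G \<subseteq> A)"
  have "\<Union>\<G> - A \<in> Fpow S" using finite_Union_Fpow[OF assms(1)] unfolding Fpow_def by auto
  hence "\<Union>\<G> - A \<in> inner_cross S \<G>"
    unfolding inner_cross_def cross_sets_def using no by blast
  thus False using assms(2) by blast
qed

lemma cross_sets_antimono: "\<F> \<subseteq> \<G> \<Longrightarrow> cross_sets S \<G> \<subseteq> cross_sets S \<F>"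
  unfolding cross_sets_def by blast

text \<open>A bowtie needs only its right-hand family: the best possible left-hand family consists of
  the sets crossing the right-hand one.\<close>

lemma cut_comp_iff:
  assumes rel: "R \<subseteq> Fpow S \<times> Fpow S" and mono: "monotone_rel S R"
  shows "(F, G) \<in> cut_comp S R T \<longleftrightarrow> F \<in> Fpow S \<and> G \<in> Fpow S \<and>
    (\<exists>\<G>\<in>Fpow (Fpow S). (\<forall>H\<in>cross_sets S \<G>. (F, H) \<in> R) \<and> (\<forall>G'\<in>\<G>. (G', G) \<in> T))"
    (is "?L \<longleftrightarrow> ?P \<and> ?Q \<and> (\<exists>\<G>\<in>_. ?E \<G> \<and> ?T \<G>)")
proof
  assume ?L
  then obtain \<F> \<G> where FG: "\<F> \<in> Fpow (Fpow S)" "\<G> \<in> Fpow (Fpow S)" "bowtie S \<F> \<G>"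
    "\<And>F'. F' \<in> \<F> \<Longrightarrow> (F, F') \<in> R" "\<And>G'. G' \<in> \<G> \<Longrightarrow> (G', G) \<in> T"
    unfolding cut_comp_def by blast
  have "?P" "?Q" using \<open>?L\<close> by (simp_all add: cut_comp_def)
  have "(F, H) \<in> R" if H: "H \<in> cross_sets S \<G>" for H
  proof -
    have "H \<inter> K \<noteq> {}" if K: "K \<in> inner_cross S \<F>" for K
    proof -
      obtain G' where "G' \<in> \<G>" "G' \<subseteq> K"
        using FG(3) K unfolding inner_cross_def bowtie_def by blast
      thus ?thesis using H unfolding cross_sets_def by blast
    qed
    then obtain F' where F': "F' \<in> \<F>" "F' \<subseteq> H" using inner_cross_dual[OF FG(1)] by blast
    moreover have "H \<in> Fpow S" using H unfolding cross_sets_def by blast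
    ultimately show ?thesis
      using mono FG(4)[of F'] rel unfolding monotone_rel_def by blast
  qed
  thus "?P \<and> ?Q \<and> (\<exists>\<G>\<in>Fpow (Fpow S). ?E \<G> \<and> ?T \<G>)"
    using FG(2,5) \<open>?P\<close> \<open>?Q\<close> by blast
next
  assume "?P \<and> ?Q \<and> (\<exists>\<G>\<in>Fpow (Fpow S). ?E \<G> \<and> ?T \<G>)"
  then obtain \<G> where *: ?P ?Q and G: "\<G> \<in> Fpow (Fpow S)" "?E \<G>" "?T \<G>"
    by blast
  have "bowtie S (inner_cross S \<G>) \<G>"
    unfolding bowtie_def
  proof
    fix H assume "H \<in> cross_sets S (inner_cross S \<G>)"
    hence "H \<inter> K \<noteq> {}" if "K \<in> inner_cross S \<G>" for K
      using that unfolding cross_sets_def[of S "inner_cross S \<G>"] by blast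
    thus "\<exists>G\<in>\<G>. G \<subseteq> H" using inner_cross_dual[OF G(1)] by blast
  qed
  thus ?L
    using * G inner_cross_Fpow[OF G(1)] unfolding cut_comp_def inner_cross_def by blast
qed


section \<open>Entailment of joins of meets\<close>

locale cut_idempotent_relation =
  fixes S :: "'a set" and R :: "('a set \<times> 'a set) set"
  assumes rel: "R \<subseteq> Fpow S \<times> Fpow S"
    and mono: "monotone_rel S R"
    and idem: "cut_idempotent S R"
begin

definition entails :: "'a set \<Rightarrow> 'a set set \<Rightarrow> bool"  (infix \<open>\<turnstile>\<close> 50)
  where "F \<turnstile> \<G> \<longleftrightarrow> F \<in> Fpow S \<and> (\<forall>H\<in>cross_sets S \<G>. (F, H) \<in> R)"

lemma R_mono: "(F, G) \<in> R \<Longrightarrow> F \<subseteq> F' \<Longrightarrow> G \<subseteq> G' \<Longrightarrow> F' \<in> Fpow S \<Longrightarrow> G' \<in> Fpow S \<Longrightarrow> (F', G') \<in> R"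
  using mono rel unfolding monotone_rel_def by blast

lemma R_carrier: "(F, G) \<in> R \<Longrightarrow> F \<in> Fpow S" "(F, G) \<in> R \<Longrightarrow> G \<in> Fpow S"
  using rel by auto

lemma entails_Fpow: "F \<turnstile> \<G> \<Longrightarrow> F \<in> Fpow S"
  unfolding entails_def by simp

lemma entails_mono: "F \<turnstile> \<G> \<Longrightarrow> F \<subseteq> F' \<Longrightarrow> F' \<in> Fpow S \<Longrightarrow> \<G> \<subseteq> \<G>' \<Longrightarrow> F' \<turnstile> \<G>'"
  unfolding entails_def using cross_sets_antimono[of \<G> \<G>' S] R_mono
  by (meson R_carrier(2) order_refl subsetD)

lemma entails_iff_inner_cross:
  assumes "\<G> \<in> Fpow (Fpow S)"
  shows "F \<turnstile> \<G> \<longleftrightarrow> F \<in> Fpow S \<and> (\<forall>H\<in>inner_cross S \<G>. (F, H) \<in> R)"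
proof -
  have "(F, H) \<in> R"
    if "F \<in> Fpow S" "\<forall>K\<in>inner_cross S \<G>. (F, K) \<in> R" and H: "H \<in> cross_sets S \<G>" for H
  proof -
    obtain K where "K \<in> inner_cross S \<G>" "K \<subseteq> H"
      using cross_contains_inner_cross[OF assms H] .
    moreover have "H \<in> Fpow S" using H by (simp add: cross_sets_def)
    ultimately show ?thesis using R_mono[of F K F H] that by blast
  qed
  thus ?thesis unfolding entails_def inner_cross_def by blast
qed

lemma entails_singleton:
  assumes "F \<in> Fpow S" "\<And>g. g \<in> G \<Longrightarrow> (F, {g}) \<in> R"
  shows "F \<turnstile> {G}"
  unfolding entails_def
proof (intro conjI ballI)
  fix H assume "H \<in> cross_sets S {G}"
  then obtain g where "g \<in> G" "g \<in> H" "H \<in> Fpow S" unfolding cross_sets_def by blast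
  thus "(F, H) \<in> R" using R_mono[OF assms(2), of g F H] assms(1) by blast
qed fact

lemma entails_singletonD:
  assumes "F \<turnstile> {G}" "g \<in> G" "G \<subseteq> S"
  shows "(F, {g}) \<in> R"
proof -
  have "{g} \<in> cross_sets S {G}" using assms(2,3) unfolding cross_sets_def Fpow_def by blast
  thus ?thesis using assms(1) unfolding entails_def by blast
qed

text \<open>The distributive law: a set missing some \<open>G \<in> \<G>\<close> and some \<open>H \<in> \<H>\<close> misses \<open>G \<union> H\<close>, so every
  set crossing all the unions crosses one of the two families.\<close>

lemma entails_meet:
  assumes "F \<turnstile> \<G>" "F \<turnstile> \<H>"
  shows "F \<turnstile> {G \<union> H |G H. G \<in> \<G> \<and> H \<in> \<H>}"
  unfolding entails_def
proof (intro conjI ballI)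
  fix K assume K: "K \<in> cross_sets S {G \<union> H |G H. G \<in> \<G> \<and> H \<in> \<H>}"
  hence "K \<in> cross_sets S \<G> \<or> K \<in> cross_sets S \<H>"
    unfolding cross_sets_def by (clarsimp, blast)
  thus "(F, K) \<in> R" using assms unfolding entails_def by blast
qed (use assms entails_Fpow in blast)

lemma finite_unions: "finite \<G> \<Longrightarrow> finite \<H> \<Longrightarrow> finite {G \<union> H |G H. G \<in> \<G> \<and> H \<in> \<H>}"
  by (rule finite_image_set2) auto

lemma R_iff_cut:
  "(F, G) \<in> R \<longleftrightarrow> F \<in> Fpow S \<and> G \<in> Fpow S \<and> (\<exists>\<G>\<in>Fpow (Fpow S). F \<turnstile> \<G> \<and> (\<forall>G'\<in>\<G>. (G', G) \<in> R))"
  using cut_comp_iff[OF rel mono, of F G R] idem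
  unfolding cut_idempotent_def entails_def by auto

lemma entails_trans:
  assumes "F \<turnstile> \<H>" "finite \<H>" "\<And>H. H \<in> \<H> \<Longrightarrow> H \<turnstile> \<G>"
  shows "F \<turnstile> \<G>"
  unfolding entails_def
proof (intro conjI ballI)
  fix K assume K: "K \<in> cross_sets S \<G>"
  have "\<H> \<in> Fpow (Fpow S)" using assms(2,3) entails_Fpow unfolding Fpow_def by auto
  moreover have "\<forall>H\<in>\<H>. (H, K) \<in> R" using assms(3) K unfolding entails_def by blast
  moreover have "K \<in> Fpow S" using K by (simp add: cross_sets_def)
  ultimately show "(F, K) \<in> R" using R_iff_cut assms(1) entails_Fpow by blast
qed (use assms entails_Fpow in blast)

text \<open>Interpolation of finitely many inequalities simultaneously: choose an interpolant for each
  of them and take the meet of these by distributivity.  The property \<open>P\<close> is what the interpolants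
  satisfy, so that the lemma serves for cut-idempotence and for divisibility.\<close>

lemma interpolate_finite:
  assumes "finite C" "F \<in> Fpow S"
    and step: "\<And>K. K \<in> C \<Longrightarrow> \<exists>\<H>\<in>Fpow (Fpow S). F \<turnstile> \<H> \<and> (\<forall>H\<in>\<H>. P H K)"
    and up: "\<And>H H' K. P H K \<Longrightarrow> H \<subseteq> H' \<Longrightarrow> H' \<in> Fpow S \<Longrightarrow> P H' K"
  shows "\<exists>\<H>\<in>Fpow (Fpow S). F \<turnstile> \<H> \<and> (\<forall>H\<in>\<H>. \<forall>K\<in>C. P H K)"
  using assms(1) step
proof (induction C)
  case empty
  \<comment> \<open>The empty meet is the top, which as a join of meets is \<open>{{}}\<close>; no set crosses it.\<close>
  have "F \<turnstile> {{}}" using assms(2) unfolding entails_def cross_sets_def by simp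
  thus ?case by (intro bexI[of _ "{{}}"]) (auto simp: Fpow_def)
next
  case (insert K C)
  obtain \<H>1 where 1: "\<H>1 \<in> Fpow (Fpow S)" "F \<turnstile> \<H>1" "\<forall>H\<in>\<H>1. \<forall>K\<in>C. P H K"
    using insert by blast
  obtain \<H>2 where 2: "\<H>2 \<in> Fpow (Fpow S)" "F \<turnstile> \<H>2" "\<forall>H\<in>\<H>2. P H K"
    using insert by blast
  let ?U = "{G \<union> H |G H. G \<in> \<H>1 \<and> H \<in> \<H>2}"
  have U: "?U \<in> Fpow (Fpow S)"
    using 1(1) 2(1) finite_unions[of \<H>1 \<H>2] unfolding Fpow_def by auto
  have "P (G \<union> H) K'" if "G \<in> \<H>1" "H \<in> \<H>2" "K' \<in> insert K C" for G H K'
  proof -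
    have "G \<union> H \<in> Fpow S" using U that unfolding Fpow_def by blast
    thus ?thesis
      using up[of G K' "G \<union> H"] up[of H K' "G \<union> H"] 1(3) 2(3) that by blast
  qed
  thus ?case using U entails_meet[OF 1(2) 2(2)] by blast
qed

lemma entails_interpolate:
  assumes "F \<turnstile> \<G>" "\<G> \<in> Fpow (Fpow S)"
  obtains \<H> where "\<H> \<in> Fpow (Fpow S)" "F \<turnstile> \<H>" "\<forall>H\<in>\<H>. H \<turnstile> \<G>"
proof -
  have "\<exists>\<H>\<in>Fpow (Fpow S). F \<turnstile> \<H> \<and> (\<forall>H\<in>\<H>. \<forall>K\<in>inner_cross S \<G>. (H, K) \<in> R)"
  proof (rule interpolate_finite)
    show "finite (inner_cross S \<G>)" using inner_cross_Fpow[OF assms(2)] by (simp add: Fpow_def)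
    show "F \<in> Fpow S" using assms(1) by (rule entails_Fpow)
    show "\<exists>\<H>\<in>Fpow (Fpow S). F \<turnstile> \<H> \<and> (\<forall>H\<in>\<H>. (H, K) \<in> R)" if "K \<in> inner_cross S \<G>" for K
      using assms that entails_iff_inner_cross R_iff_cut by blast
    show "(H', K) \<in> R" if "(H, K) \<in> R" "H \<subseteq> H'" "H' \<in> Fpow S" for H H' K
      using that R_mono R_carrier by blast
  qed
  then obtain \<H> where H: "\<H> \<in> Fpow (Fpow S)" "F \<turnstile> \<H>" "\<forall>H\<in>\<H>. \<forall>K\<in>inner_cross S \<G>. (H, K) \<in> R"
    by blast
  have "H \<turnstile> \<G>" if "H \<in> \<H>" for H
  proof -
    have "H \<in> Fpow S" using that H(1) unfolding Fpow_def by blast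
    thus ?thesis using that H(3) entails_iff_inner_cross[OF assms(2)] by blast
  qed
  thus ?thesis using that H by blast
qed


section \<open>Rounding and quasi-ideals\<close>

abbreviation BS :: "'a set set" where "BS \<equiv> bounded_sets S R"

definition rounding :: "'a set set \<Rightarrow> 'a set set"
  where "rounding \<P> = {F. \<exists>\<G>\<in>Fpow \<P>. F \<turnstile> \<G>}"

lemma BS_subset: "BS \<subseteq> Fpow S"
  unfolding bounded_sets_def by blast

lemma Fpow_BS: "\<P> \<subseteq> BS \<Longrightarrow> \<G> \<in> Fpow \<P> \<Longrightarrow> \<G> \<in> Fpow (Fpow S)"
  using BS_subset unfolding Fpow_def by blast

lemma R_BS: "(F, G) \<in> R \<Longrightarrow> F \<in> BS"
  using R_carrier unfolding bounded_sets_def by blast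

text \<open>Either some set crosses \<open>\<G>\<close>, which bounds \<open>F\<close>, or the empty set belongs to \<open>\<G>\<close>; then the
  empty set is bounded, and so is every finite set by monotonicity.\<close>

lemma entails_BS:
  assumes "F \<turnstile> \<G>" "\<G> \<in> Fpow BS"
  shows "F \<in> BS"
proof (cases "{} \<in> \<G>")
  case True
  then obtain G where "({}, G) \<in> R" using assms(2) unfolding Fpow_def bounded_sets_def by blast
  hence "(F, G) \<in> R" using R_mono[of "{}" G F G] R_carrier entails_Fpow[OF assms(1)] by blast
  thus ?thesis by (rule R_BS)
next
  case False
  have U: "\<Union>\<G> \<in> Fpow S" using finite_Union_Fpow Fpow_BS assms(2) by blast
  have "\<Union>\<G> \<inter> G \<noteq> {}" if "G \<in> \<G>" for G
  proof -
    have "G \<subseteq> \<Union>\<G>" "G \<noteq> {}" using that False by auto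
    thus ?thesis by blast
  qed
  hence "\<Union>\<G> \<in> cross_sets S \<G>" using U unfolding cross_sets_def by blast
  thus ?thesis using assms(1) R_BS unfolding entails_def by blast
qed

lemma rounding_subset_BS: "\<P> \<subseteq> BS \<Longrightarrow> rounding \<P> \<subseteq> BS"
  using entails_BS Fpow_mono[of \<P> BS] unfolding rounding_def by blast

lemma rounding_mono: "\<P> \<subseteq> \<Q> \<Longrightarrow> rounding \<P> \<subseteq> rounding \<Q>"
  using Fpow_mono[of \<P> \<Q>] unfolding rounding_def by blast

lemma quasi_ideal_iff: "quasi_ideal S R \<Q> \<longleftrightarrow> \<Q> \<subseteq> BS \<and> rounding \<Q> = \<Q>"
proof -
  have *: "F \<in> rounding \<Q> \<longleftrightarrow> (\<exists>\<G>\<in>Fpow \<Q>. \<forall>H\<in>cross_sets S \<G>. (F, H) \<in> R)" if "F \<in> BS" for F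
    using that BS_subset unfolding rounding_def entails_def by blast
  show ?thesis unfolding quasi_ideal_def
  proof (intro iffI conjI; elim conjE)
    assume Q: "\<Q> \<subseteq> BS"
      and eq: "\<forall>F\<in>BS. (F \<in> \<Q>) = (\<exists>\<G>\<in>Fpow \<Q>. \<forall>G\<in>cross_sets S \<G>. (F, G) \<in> R)"
    show "rounding \<Q> = \<Q>" using rounding_subset_BS[OF Q] * eq Q by blast
  next
    assume "\<Q> \<subseteq> BS" "rounding \<Q> = \<Q>"
    thus "\<forall>F\<in>BS. (F \<in> \<Q>) = (\<exists>\<G>\<in>Fpow \<Q>. \<forall>G\<in>cross_sets S \<G>. (F, G) \<in> R)" using * by blast
  qed
qed

lemma entails_rounding:
  assumes "F \<turnstile> \<H>" "\<H> \<in> Fpow (rounding \<P>)"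
  shows "F \<in> rounding \<P>"
proof -
  have "\<forall>H\<in>\<H>. \<exists>\<G>. \<G> \<in> Fpow \<P> \<and> H \<turnstile> \<G>" using assms(2) unfolding Fpow_def rounding_def by blast
  then obtain g where g: "\<And>H. H \<in> \<H> \<Longrightarrow> g H \<in> Fpow \<P> \<and> H \<turnstile> g H" by metis
  have fin: "finite \<H>" using assms(2) unfolding Fpow_def by simp
  have U: "\<Union>(g ` \<H>) \<in> Fpow \<P>" using g fin unfolding Fpow_def by auto
  have "H \<turnstile> \<Union>(g ` \<H>)" if "H \<in> \<H>" for H
    using entails_mono[of H "g H" H "\<Union>(g ` \<H>)"] g[OF that] that entails_Fpow by blast
  hence "F \<turnstile> \<Union>(g ` \<H>)" using entails_trans[OF assms(1) fin] by blast
  thus ?thesis using U unfolding rounding_def by blast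
qed

text \<open>One inclusion of idempotence is transitivity of \<open>\<turnstile>\<close>, the other one is interpolation.\<close>

lemma rounding_quasi_ideal:
  assumes "\<P> \<subseteq> BS"
  shows "quasi_ideal S R (rounding \<P>)"
proof -
  have "rounding (rounding \<P>) \<subseteq> rounding \<P>"
    using entails_rounding unfolding rounding_def[of "rounding \<P>"] by blast
  moreover have "F \<in> rounding (rounding \<P>)" if F: "F \<in> rounding \<P>" for F
  proof -
    obtain \<G> where G: "\<G> \<in> Fpow \<P>" "F \<turnstile> \<G>" using F unfolding rounding_def by blast
    obtain \<H> where H: "\<H> \<in> Fpow (Fpow S)" "F \<turnstile> \<H>" "\<forall>H\<in>\<H>. H \<turnstile> \<G>"
      using entails_interpolate[OF G(2) Fpow_BS[OF assms G(1)]] .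
    have "\<H> \<subseteq> rounding \<P>" using H(3) G(1) unfolding rounding_def by blast
    hence "\<H> \<in> Fpow (rounding \<P>)" using H(1) unfolding Fpow_def by blast
    thus ?thesis using H(2) unfolding rounding_def[of "rounding \<P>"] by blast
  qed
  ultimately show ?thesis using quasi_ideal_iff rounding_subset_BS[OF assms] by blast
qed

lemma qi_entails: "quasi_ideal S R \<Q> \<Longrightarrow> F \<turnstile> \<G> \<Longrightarrow> \<G> \<in> Fpow \<Q> \<Longrightarrow> F \<in> \<Q>"
  unfolding quasi_ideal_iff rounding_def by blast

lemma qi_obtain:
  assumes "quasi_ideal S R \<Q>" "F \<in> \<Q>"
  obtains \<G> where "F \<turnstile> \<G>" "\<G> \<in> Fpow \<Q>" "\<G> \<in> Fpow (Fpow S)"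
  using assms Fpow_BS unfolding quasi_ideal_iff rounding_def by blast

lemma qi_up:
  assumes Q: "quasi_ideal S R \<Q>" and F: "F \<in> \<Q>" and F': "F \<subseteq> F'" "F' \<in> Fpow S"
  shows "F' \<in> \<Q>"
proof -
  obtain \<G> where "F \<turnstile> \<G>" "\<G> \<in> Fpow \<Q>" using qi_obtain[OF Q F] .
  thus ?thesis using qi_entails[OF Q] entails_mono F' by blast
qed

lemma qi_BS: "quasi_ideal S R \<Q> \<Longrightarrow> \<Q> \<subseteq> BS"
  unfolding quasi_ideal_iff by simp

lemma unions_Fpow:
  assumes P: "quasi_ideal S R \<P>" and Q: "quasi_ideal S R \<Q>"
    and G: "\<G> \<in> Fpow \<P>" and H: "\<H> \<in> Fpow \<Q>"
  shows "{G \<union> H |G H. G \<in> \<G> \<and> H \<in> \<H>} \<in> Fpow (\<P> \<inter> \<Q>)"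
proof -
  have "G \<union> H \<in> \<P> \<inter> \<Q>" if "G \<in> \<G>" "H \<in> \<H>" for G H
  proof -
    have GH: "G \<in> \<P>" "H \<in> \<Q>" using that assms(3,4) by (auto simp: Fpow_def)
    hence "G \<in> Fpow S" "H \<in> Fpow S" using qi_BS[OF P] qi_BS[OF Q] BS_subset by blast+
    hence "G \<union> H \<in> Fpow S" by (simp add: Fpow_def)
    thus ?thesis using qi_up[OF P GH(1), of "G \<union> H"] qi_up[OF Q GH(2), of "G \<union> H"] by simp
  qed
  moreover have "finite {G \<union> H |G H. G \<in> \<G> \<and> H \<in> \<H>}"
    using G H by (intro finite_unions) (simp_all add: Fpow_def)
  ultimately show ?thesis unfolding Fpow_def by blast
qed

text \<open>The distributive law makes the intersection of two quasi-ideals a fixed point of the rounding.\<close>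

lemma qi_entails_Int:
  assumes P: "quasi_ideal S R \<P>" and Q: "quasi_ideal S R \<Q>" and F: "F \<in> \<P>" "F \<in> \<Q>"
  obtains \<G> where "\<G> \<in> Fpow (\<P> \<inter> \<Q>)" "F \<turnstile> \<G>"
proof -
  obtain \<G> where G: "F \<turnstile> \<G>" "\<G> \<in> Fpow \<P>" using qi_obtain[OF P F(1)] .
  obtain \<H> where H: "F \<turnstile> \<H>" "\<H> \<in> Fpow \<Q>" using qi_obtain[OF Q F(2)] .
  show ?thesis using that unions_Fpow[OF P Q G(2) H(2)] entails_meet[OF G(1) H(1)] by blast
qed

lemma qi_Int:
  assumes P: "quasi_ideal S R \<P>" and Q: "quasi_ideal S R \<Q>"
  shows "quasi_ideal S R (\<P> \<inter> \<Q>)"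
proof -
  have "rounding (\<P> \<inter> \<Q>) \<subseteq> \<P> \<inter> \<Q>"
    using rounding_mono[of "\<P> \<inter> \<Q>" \<P>] rounding_mono[of "\<P> \<inter> \<Q>" \<Q>] P Q
    unfolding quasi_ideal_iff by blast
  moreover have "\<P> \<inter> \<Q> \<subseteq> rounding (\<P> \<inter> \<Q>)"
    using qi_entails_Int[OF P Q] unfolding rounding_def by blast
  ultimately show ?thesis using qi_BS[OF P] unfolding quasi_ideal_iff by blast
qed

lemma lower_of_iff: "F \<in> lower_of S R G \<longleftrightarrow> (F, G) \<in> R"
  unfolding lower_of_def using R_carrier by blast

lemma lower_of_subset_BS: "lower_of S R G \<subseteq> BS"
  using R_BS lower_of_iff by blast

lemma lower_of_mono: "G \<subseteq> G' \<Longrightarrow> G' \<in> Fpow S \<Longrightarrow> lower_of S R G \<subseteq> lower_of S R G'"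
  using R_mono R_carrier lower_of_iff by blast

text \<open>Cut-idempotence for the pairs with right-hand side \<open>G\<close> is the fixed point equation of the
  rounding.\<close>

lemma lower_of_qi:
  assumes "G \<in> Fpow S"
  shows "quasi_ideal S R (lower_of S R G)"
proof -
  have "F \<in> rounding (lower_of S R G) \<longleftrightarrow> F \<in> lower_of S R G" for F
  proof -
    have "\<G> \<in> Fpow (lower_of S R G) \<longleftrightarrow> \<G> \<in> Fpow (Fpow S) \<and> (\<forall>G'\<in>\<G>. (G', G) \<in> R)" for \<G>
      unfolding Fpow_def[of "Fpow S"] Fpow_def[of "lower_of S R G"]
      using lower_of_iff R_carrier(1) by auto
    thus ?thesis
      using R_iff_cut[of F G] assms entails_Fpow lower_of_iff unfolding rounding_def by blast
  qed
  thus ?thesis unfolding quasi_ideal_iff using lower_of_subset_BS by blast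
qed

lemma BS_qi: "quasi_ideal S R BS"
proof -
  have "F \<in> rounding BS" if F: "F \<in> BS" for F
  proof -
    obtain G where G: "G \<in> Fpow S" "F \<in> lower_of S R G"
      using F lower_of_iff unfolding bounded_sets_def by blast
    have "F \<in> rounding (lower_of S R G)"
      using lower_of_qi[OF G(1)] G(2) unfolding quasi_ideal_iff by simp
    thus ?thesis using rounding_mono[OF lower_of_subset_BS] by blast
  qed
  thus ?thesis unfolding quasi_ideal_iff using rounding_subset_BS[of BS] by blast
qed


section \<open>The arithmetic lattice of quasi-ideals\<close>

abbreviation L :: "'a set set gorder" where "L \<equiv> QI S R"

lemma QI_simps:
  "\<P> \<in> carrier L \<longleftrightarrow> quasi_ideal S R \<P>"
  "\<P> \<sqsubseteq>\<^bsub>L\<^esub> \<Q> \<longleftrightarrow> \<P> \<subseteq> \<Q>"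
  unfolding QI_def by auto

lemma QI_partial_order: "partial_order L"
  by unfold_locales (auto simp: QI_def)

lemma carrier_Union_BS: "\<A> \<subseteq> carrier L \<Longrightarrow> \<Union>\<A> \<subseteq> BS"
  using qi_BS QI_simps(1) by blast

lemma carrier_rounding: "\<A> \<subseteq> carrier L \<Longrightarrow> \<P> \<in> \<A> \<Longrightarrow> rounding \<P> = \<P>"
  using quasi_ideal_iff QI_simps(1) by blast

lemma rounding_least: "\<A> \<subseteq> carrier L \<Longrightarrow> least L (rounding (\<Union>\<A>)) (Upper L \<A>)"
proof (rule least_UpperI)
  assume A: "\<A> \<subseteq> carrier L"
  show "rounding (\<Union>\<A>) \<in> carrier L"
    using rounding_quasi_ideal[OF carrier_Union_BS[OF A]] by (simp add: QI_simps)
  show "P \<sqsubseteq>\<^bsub>L\<^esub> rounding (\<Union>\<A>)" if "P \<in> \<A>" for P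
    using rounding_mono[of P "\<Union>\<A>"] carrier_rounding[OF A that] that by (auto simp: QI_simps)
  show "rounding (\<Union>\<A>) \<sqsubseteq>\<^bsub>L\<^esub> Q" if "Q \<in> Upper L \<A>" for Q
  proof -
    have "\<Union>\<A> \<subseteq> Q" using A that unfolding Upper_def QI_simps by blast
    moreover have "Q \<in> carrier L" using that unfolding Upper_def by blast
    ultimately show ?thesis using rounding_mono[of "\<Union>\<A>" Q] by (auto simp: QI_simps quasi_ideal_iff)
  qed
qed

lemma rounding_greatest: "\<A> \<subseteq> carrier L \<Longrightarrow> greatest L (rounding (BS \<inter> \<Inter>\<A>)) (Lower L \<A>)"
proof (rule greatest_LowerI)
  assume A: "\<A> \<subseteq> carrier L"
  show "rounding (BS \<inter> \<Inter>\<A>) \<in> carrier L"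
    using rounding_quasi_ideal[of "BS \<inter> \<Inter>\<A>"] by (auto simp: QI_simps)
  show "rounding (BS \<inter> \<Inter>\<A>) \<sqsubseteq>\<^bsub>L\<^esub> P" if "P \<in> \<A>" for P
    using rounding_mono[of "BS \<inter> \<Inter>\<A>" P] carrier_rounding[OF A that] that
    by (auto simp: QI_simps)
  show "Q \<sqsubseteq>\<^bsub>L\<^esub> rounding (BS \<inter> \<Inter>\<A>)" if "Q \<in> Lower L \<A>" for Q
  proof -
    have "Q \<subseteq> \<Inter>\<A>" using A that unfolding Lower_def QI_simps by blast
    moreover have "Q \<in> carrier L" using that unfolding Lower_def by blast
    ultimately show ?thesis
      using rounding_mono[of Q "BS \<inter> \<Inter>\<A>"] by (auto simp: QI_simps quasi_ideal_iff)
  qed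
qed

lemma QI_complete_lattice: "complete_lattice L"
  using partial_order.complete_latticeI[OF QI_partial_order] rounding_least rounding_greatest
  by blast

lemma Sup_eq: "\<A> \<subseteq> carrier L \<Longrightarrow> \<Squnion>\<^bsub>L\<^esub>\<A> = rounding (\<Union>\<A>)"
  unfolding sup_def
  by (rule some_equality)
    (use rounding_least partial_order.least_unique[OF QI_partial_order] in blast)+

lemma Inf_eq: "\<A> \<subseteq> carrier L \<Longrightarrow> \<Sqinter>\<^bsub>L\<^esub>\<A> = rounding (BS \<inter> \<Inter>\<A>)"
  unfolding inf_def
  by (rule some_equality)
    (use rounding_greatest partial_order.greatest_unique[OF QI_partial_order] in blast)+

lemma finite_Inf_eq:
  assumes "finite \<A>" "\<A> \<subseteq> carrier L"
  shows "\<Sqinter>\<^bsub>L\<^esub>\<A> = BS \<inter> \<Inter>\<A>"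
proof -
  have "quasi_ideal S R (BS \<inter> \<Inter>\<A>)"
    using assms
  proof (induction \<A>)
    case empty
    thus ?case using BS_qi by simp
  next
    case (insert P \<A>)
    hence "quasi_ideal S R (P \<inter> (BS \<inter> \<Inter>\<A>))" using qi_Int by (auto simp: QI_simps)
    thus ?case by (simp add: Int_left_commute)
  qed
  thus ?thesis using Inf_eq[OF assms(2)] by (simp add: quasi_ideal_iff)
qed

lemma meet_eq:
  assumes "\<P> \<in> carrier L" "\<Q> \<in> carrier L"
  shows "\<P> \<sqinter>\<^bsub>L\<^esub> \<Q> = \<P> \<inter> \<Q>"
  using finite_Inf_eq[of "{\<P>, \<Q>}"] assms qi_BS
  unfolding meet_def by (auto simp: QI_simps)

lemma directed_finite_subset:
  assumes "directed_in L D" "finite \<G>" "\<G> \<subseteq> \<Union>D"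
  shows "\<exists>d\<in>D. \<G> \<subseteq> d"
  using assms(2,3)
proof (induction \<G>)
  case empty
  thus ?case using assms(1) unfolding directed_in_def by blast
next
  case (insert G \<G>)
  then obtain d d' where "d \<in> D" "\<G> \<subseteq> d" "d' \<in> D" "G \<in> d'" by blast
  moreover from this obtain e where "e \<in> D" "d \<subseteq> e" "d' \<subseteq> e"
    using assms(1) unfolding directed_in_def QI_simps by blast
  ultimately show ?case by blast
qed

text \<open>The rounding of a union uses only finitely many members of it at a time, and these lie in a
  single quasi-ideal of a directed family.\<close>

lemma directed_Sup_eq:
  assumes D: "directed_in L D"
  shows "\<Squnion>\<^bsub>L\<^esub>D = \<Union>D"
proof -
  have sub: "D \<subseteq> carrier L" using D unfolding directed_in_def by blast
  have "F \<in> \<Union>D" if F: "F \<in> rounding (\<Union>D)" for F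
  proof -
    obtain \<G> where G: "\<G> \<in> Fpow (\<Union>D)" "F \<turnstile> \<G>" using F unfolding rounding_def by blast
    obtain d where d: "d \<in> D" "\<G> \<subseteq> d"
      using directed_finite_subset[OF D] G(1) unfolding Fpow_def by blast
    have "F \<in> d" using qi_entails[of d F \<G>] d sub G by (auto simp: QI_simps Fpow_def)
    thus ?thesis using d(1) by blast
  qed
  moreover have "d \<subseteq> rounding (\<Union>D)" if "d \<in> D" for d
    using rounding_mono[of d "\<Union>D"] carrier_rounding[OF sub that] that by auto
  ultimately show ?thesis unfolding Sup_eq[OF sub] by blast
qed

lemma rounding_finite: "finite \<G> \<Longrightarrow> F \<in> rounding \<G> \<longleftrightarrow> F \<turnstile> \<G>"
  unfolding rounding_def using entails_mono[of F _ F \<G>] entails_Fpow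
  by (auto simp: Fpow_def)

lemma rounding_finite_directed:
  assumes "quasi_ideal S R \<Q>"
  shows "directed_in L (rounding ` Fpow \<Q>)" "\<Union>(rounding ` Fpow \<Q>) = \<Q>"
proof -
  have "rounding \<G> \<in> carrier L" if "\<G> \<in> Fpow \<Q>" for \<G>
    using rounding_quasi_ideal[of \<G>] that qi_BS[OF assms] by (auto simp: QI_simps Fpow_def)
  moreover have "\<exists>\<K>\<in>Fpow \<Q>. rounding \<G> \<subseteq> rounding \<K> \<and> rounding \<H> \<subseteq> rounding \<K>"
    if "\<G> \<in> Fpow \<Q>" "\<H> \<in> Fpow \<Q>" for \<G> \<H>
    using that rounding_mono by (intro bexI[of _ "\<G> \<union> \<H>"]) (auto simp: Fpow_def)
  ultimately show "directed_in L (rounding ` Fpow \<Q>)"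
    unfolding directed_in_def by (auto simp: QI_simps Fpow_not_empty)
  have "rounding \<Q> \<subseteq> \<Union>(rounding ` Fpow \<Q>)"
    unfolding rounding_def[of \<Q>] using rounding_finite by (auto simp: Fpow_def)
  moreover have "rounding \<G> \<subseteq> rounding \<Q>" if "\<G> \<in> Fpow \<Q>" for \<G>
    using that rounding_mono[of \<G> \<Q>] by (auto simp: Fpow_def)
  ultimately show "\<Union>(rounding ` Fpow \<Q>) = \<Q>"
    using assms unfolding quasi_ideal_iff by blast
qed

text \<open>From left to right, test \<open>\<P> \<lless> \<Q>\<close> on the directed union of the roundings of the finite subsets
  of \<open>\<Q>\<close>.  From right to left, the finite family \<open>\<G>\<close> is absorbed by one member of the directed
  family, and everything that entails \<open>\<G>\<close> then belongs to this member.\<close>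

lemma way_below_iff:
  assumes "quasi_ideal S R \<P>" "quasi_ideal S R \<Q>"
  shows "way_below L \<P> \<Q> \<longleftrightarrow> (\<exists>\<G>\<in>Fpow \<Q>. \<forall>F\<in>\<P>. F \<turnstile> \<G>)"
proof
  assume "way_below L \<P> \<Q>"
  moreover have "\<Squnion>\<^bsub>L\<^esub>(rounding ` Fpow \<Q>) = \<Q>"
    using directed_Sup_eq rounding_finite_directed[OF assms(2)] by simp
  ultimately have "\<exists>d\<in>rounding ` Fpow \<Q>. \<P> \<subseteq> d"
    using rounding_finite_directed(1)[OF assms(2)] unfolding way_below_def QI_simps by blast
  then obtain \<G> where G: "\<G> \<in> Fpow \<Q>" "\<P> \<subseteq> rounding \<G>" by blast
  moreover have "finite \<G>" using G(1) by (simp add: Fpow_def)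
  ultimately show "\<exists>\<G>\<in>Fpow \<Q>. \<forall>F\<in>\<P>. F \<turnstile> \<G>" using rounding_finite by blast
next
  assume "\<exists>\<G>\<in>Fpow \<Q>. \<forall>F\<in>\<P>. F \<turnstile> \<G>"
  then obtain \<G> where G: "\<G> \<in> Fpow \<Q>" "\<forall>F\<in>\<P>. F \<turnstile> \<G>" by blast
  show "way_below L \<P> \<Q>" unfolding way_below_def
  proof (intro conjI allI impI)
    fix D assume D: "directed_in L D" and "\<Q> \<sqsubseteq>\<^bsub>L\<^esub> \<Squnion>\<^bsub>L\<^esub>D"
    hence "\<G> \<subseteq> \<Union>D" using G(1) directed_Sup_eq[OF D] by (auto simp: QI_simps Fpow_def)
    then obtain d where d: "d \<in> D" "\<G> \<subseteq> d"
      using directed_finite_subset[OF D, of \<G>] G(1) unfolding Fpow_def by blast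
    have "quasi_ideal S R d" using D d(1) unfolding directed_in_def by (auto simp: QI_simps)
    hence "\<P> \<subseteq> d" using qi_entails[of d _ \<G>] G d(2) by (auto simp: Fpow_def)
    thus "\<exists>d\<in>D. \<P> \<sqsubseteq>\<^bsub>L\<^esub> d" using d(1) by (auto simp: QI_simps)
  qed (use assms in \<open>auto simp: QI_simps\<close>)
qed

lemma QI_approximation:
  assumes Q: "quasi_ideal S R \<Q>"
  shows "\<Q> = \<Squnion>\<^bsub>L\<^esub>{\<P> \<in> carrier L. way_below L \<P> \<Q>}" (is "_ = \<Squnion>\<^bsub>L\<^esub>?W")
proof -
  have "\<Union>?W = \<Q>"
  proof
    show "\<Union>?W \<subseteq> \<Q>"
    proof
      fix F assume "F \<in> \<Union>?W"
      then obtain \<P> where "quasi_ideal S R \<P>" "way_below L \<P> \<Q>" "F \<in> \<P>" by (auto simp: QI_simps)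
      then obtain \<G> where "\<G> \<in> Fpow \<Q>" "F \<turnstile> \<G>" using way_below_iff Q by blast
      thus "F \<in> \<Q>" using qi_entails[OF Q] by blast
    qed
    have "rounding \<G> \<in> ?W" if G: "\<G> \<in> Fpow \<Q>" for \<G>
    proof -
      have P: "quasi_ideal S R (rounding \<G>)"
        using rounding_quasi_ideal qi_BS[OF Q] G by (auto simp: Fpow_def)
      moreover have "\<forall>F\<in>rounding \<G>. F \<turnstile> \<G>" using rounding_finite G by (auto simp: Fpow_def)
      ultimately show ?thesis using way_below_iff[OF P Q] G by (auto simp: QI_simps)
    qed
    thus "\<Q> \<subseteq> \<Union>?W" using rounding_finite_directed(2)[OF Q] by blast
  qed
  moreover have "\<Squnion>\<^bsub>L\<^esub>?W = rounding (\<Union>?W)" by (rule Sup_eq) blast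
  ultimately show ?thesis using Q unfolding quasi_ideal_iff by simp
qed

text \<open>A set in both \<open>\<P>\<close> and the join entails finite families from \<open>\<P>\<close> and from \<open>\<Union>\<A>\<close>; the unions of
  their members belong to \<open>\<P> \<inter> \<Q>\<close> for some \<open>\<Q> \<in> \<A>\<close>, and are entailed by distributivity.\<close>

lemma QI_meet_distrib_Sup:
  assumes P: "\<P> \<in> carrier L" and A: "\<A> \<subseteq> carrier L"
  shows "\<P> \<sqinter>\<^bsub>L\<^esub> (\<Squnion>\<^bsub>L\<^esub>\<A>) = \<Squnion>\<^bsub>L\<^esub>((\<lambda>\<Q>. \<P> \<sqinter>\<^bsub>L\<^esub> \<Q>) ` \<A>)"
proof -
  have img: "(\<lambda>\<Q>. \<P> \<sqinter>\<^bsub>L\<^esub> \<Q>) ` \<A> = (\<lambda>\<Q>. \<P> \<inter> \<Q>) ` \<A>"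
    using meet_eq[OF P] A by (intro image_cong) auto
  have sub: "(\<lambda>\<Q>. \<P> \<inter> \<Q>) ` \<A> \<subseteq> carrier L" using P A qi_Int by (auto simp: QI_simps)
  have qA: "quasi_ideal S R (rounding (\<Union>\<A>))"
    using rounding_quasi_ideal[OF carrier_Union_BS[OF A]] .
  have qP: "quasi_ideal S R \<P>" using P by (simp add: QI_simps)
  have "\<P> \<inter> rounding (\<Union>\<A>) = rounding (\<Union>((\<lambda>\<Q>. \<P> \<inter> \<Q>) ` \<A>))"
  proof
    show "rounding (\<Union>((\<lambda>\<Q>. \<P> \<inter> \<Q>) ` \<A>)) \<subseteq> \<P> \<inter> rounding (\<Union>\<A>)"
      using rounding_mono[of "\<Union>((\<lambda>\<Q>. \<P> \<inter> \<Q>) ` \<A>)" \<P>]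
        rounding_mono[of "\<Union>((\<lambda>\<Q>. \<P> \<inter> \<Q>) ` \<A>)" "\<Union>\<A>"] qP
      unfolding quasi_ideal_iff by blast
    show "\<P> \<inter> rounding (\<Union>\<A>) \<subseteq> rounding (\<Union>((\<lambda>\<Q>. \<P> \<inter> \<Q>) ` \<A>))"
    proof
      fix F assume F: "F \<in> \<P> \<inter> rounding (\<Union>\<A>)"
      obtain \<G> where G: "F \<turnstile> \<G>" "\<G> \<in> Fpow \<P>" using qi_obtain[OF qP] F by blast
      obtain \<H> where H: "F \<turnstile> \<H>" "\<H> \<in> Fpow (\<Union>\<A>)" using F unfolding rounding_def by blast
      let ?U = "{G \<union> H |G H. G \<in> \<G> \<and> H \<in> \<H>}"
      have "G \<union> H \<in> \<Union>((\<lambda>\<Q>. \<P> \<inter> \<Q>) ` \<A>)" if GH: "G \<in> \<G>" "H \<in> \<H>" for G H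
      proof -
        obtain \<Q> where "\<Q> \<in> \<A>" "H \<in> \<Q>" using GH(2) H(2) unfolding Fpow_def by blast
        moreover from this have "quasi_ideal S R \<Q>" using A QI_simps(1) by blast
        moreover have "G \<in> \<P>" using GH(1) G(2) unfolding Fpow_def by blast
        ultimately have "\<Q> \<in> \<A>" "{G \<union> H} \<in> Fpow (\<P> \<inter> \<Q>)"
          using unions_Fpow[OF qP, of \<Q> "{G}" "{H}"] by (simp_all add: Fpow_def)
        thus ?thesis unfolding Fpow_def by blast
      qed
      hence "?U \<in> Fpow (\<Union>((\<lambda>\<Q>. \<P> \<inter> \<Q>) ` \<A>))"
        using finite_unions[of \<G> \<H>] G(2) H(2) unfolding Fpow_def by blast
      thus "F \<in> rounding (\<Union>((\<lambda>\<Q>. \<P> \<inter> \<Q>) ` \<A>))"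
        using entails_meet[OF G(1) H(1)] unfolding rounding_def by blast
    qed
  qed
  thus ?thesis using meet_eq[OF P] qA Sup_eq[OF A] Sup_eq[OF sub] img by (simp add: QI_simps)
qed

lemma QI_way_below_meet:
  assumes "way_below L \<P> \<Q>" "way_below L \<P> \<Q>'"
  shows "way_below L \<P> (\<Q> \<sqinter>\<^bsub>L\<^esub> \<Q>')"
proof -
  have q: "quasi_ideal S R \<P>" "quasi_ideal S R \<Q>" "quasi_ideal S R \<Q>'"
    using assms unfolding way_below_def by (auto simp: QI_simps)
  obtain \<G> where G: "\<G> \<in> Fpow \<Q>" "\<forall>F\<in>\<P>. F \<turnstile> \<G>" using assms(1) way_below_iff q by blast
  obtain \<H> where H: "\<H> \<in> Fpow \<Q>'" "\<forall>F\<in>\<P>. F \<turnstile> \<H>" using assms(2) way_below_iff q by blast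
  have "way_below L \<P> (\<Q> \<inter> \<Q>')"
    using way_below_iff[OF q(1) qi_Int[OF q(2,3)]] unions_Fpow[OF q(2,3) G(1) H(1)]
      entails_meet G(2) H(2) by blast
  thus ?thesis using meet_eq q by (simp add: QI_simps)
qed

lemma QI_arithmetic_lattice: "arithmetic_lattice L"
proof -
  interpret complete_lattice L by (rule QI_complete_lattice)
  show ?thesis
    using QI_approximation QI_meet_distrib_Sup QI_way_below_meet
    by unfold_locales (simp_all add: QI_simps(1))
qed


section \<open>Divisibility and principal quasi-ideals\<close>

lemma principal_carrier: "A \<subseteq> S \<Longrightarrow> principal_qi S R ` A \<subseteq> carrier L"
  using lower_of_qi by (auto simp: QI_simps Fpow_def)

lemma Sup_principal:
  "G \<in> Fpow S \<Longrightarrow> \<Squnion>\<^bsub>L\<^esub>(principal_qi S R ` G) = rounding (\<Union>(principal_qi S R ` G))"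
  using Sup_eq[OF principal_carrier] by (simp add: Fpow_def)

lemma Inf_principal:
  assumes "F \<in> Fpow S"
  shows "\<Sqinter>\<^bsub>L\<^esub>(principal_qi S R ` F) = {H \<in> BS. \<forall>f\<in>F. (H, {f}) \<in> R}"
proof -
  have "\<Sqinter>\<^bsub>L\<^esub>(principal_qi S R ` F) = BS \<inter> \<Inter>(principal_qi S R ` F)"
    using finite_Inf_eq principal_carrier assms by (simp add: Fpow_def)
  thus ?thesis using lower_of_iff by blast
qed

lemma Inf_principal_qi: "F \<in> Fpow S \<Longrightarrow> quasi_ideal S R (\<Sqinter>\<^bsub>L\<^esub>(principal_qi S R ` F))"
  using Inf_eq[OF principal_carrier, of F] rounding_quasi_ideal[of "BS \<inter> _"]
  by (simp add: Fpow_def)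

text \<open>Divisibility is interpolation through sets below single elements, that is, through members
  of the principal quasi-ideals.\<close>

lemma cut_single_iff:
  assumes "G \<in> Fpow S"
  shows "(F, G) \<in> cut_comp S R (single_rel S R) \<longleftrightarrow> F \<in> rounding (\<Union>(principal_qi S R ` G))"
proof -
  have "(\<G> \<in> Fpow (Fpow S) \<and> (\<forall>G'\<in>\<G>. (G', G) \<in> single_rel S R))
      \<longleftrightarrow> \<G> \<in> Fpow (\<Union>(principal_qi S R ` G))" for \<G>
    using assms unfolding Fpow_def single_rel_def lower_of_def by blast
  thus ?thesis
    using cut_comp_iff[OF rel mono, of F G "single_rel S R"] assms
    unfolding rounding_def entails_def by blast
qed

lemma divisible_iff_lower_of:
  "divisible S R \<longleftrightarrow> (\<forall>G\<in>Fpow S. lower_of S R G = \<Squnion>\<^bsub>L\<^esub>(principal_qi S R ` G))"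
proof -
  have ge: "rounding (\<Union>(principal_qi S R ` G)) \<subseteq> lower_of S R G" if "G \<in> Fpow S" for G
  proof -
    have "\<Union>(principal_qi S R ` G) \<subseteq> lower_of S R G" using lower_of_mono that by blast
    from rounding_mono[OF this] show ?thesis
      using lower_of_qi[OF that] unfolding quasi_ideal_iff by blast
  qed
  have "divisible S R \<longleftrightarrow>
      (\<forall>G\<in>Fpow S. lower_of S R G \<subseteq> rounding (\<Union>(principal_qi S R ` G)))"
  proof
    assume "divisible S R"
    thus "\<forall>G\<in>Fpow S. lower_of S R G \<subseteq> rounding (\<Union>(principal_qi S R ` G))"
      unfolding divisible_def using cut_single_iff lower_of_iff by blast
  next
    assume le: "\<forall>G\<in>Fpow S. lower_of S R G \<subseteq> rounding (\<Union>(principal_qi S R ` G))"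
    have "(F, G) \<in> cut_comp S R (single_rel S R)" if "(F, G) \<in> R" for F G
      using le cut_single_iff[OF R_carrier(2)[OF that]] that R_carrier(2)[OF that] lower_of_iff
      by blast
    thus "divisible S R" unfolding divisible_def by auto
  qed
  thus ?thesis using ge Sup_principal by auto
qed

lemma divisible_single:
  assumes "divisible S R" "(F, G) \<in> R"
  shows "\<exists>\<H>\<in>Fpow (Fpow S). F \<turnstile> \<H> \<and> (\<forall>H\<in>\<H>. \<exists>g\<in>G. (H, {g}) \<in> R)"
proof -
  have "F \<in> rounding (\<Union>(principal_qi S R ` G))"
    using assms cut_single_iff[OF R_carrier(2)] unfolding divisible_def by blast
  then obtain \<H> where H: "\<H> \<in> Fpow (\<Union>(principal_qi S R ` G))" "F \<turnstile> \<H>"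
    unfolding rounding_def by blast
  have "\<H> \<in> Fpow (Fpow S)" using H(1) R_carrier unfolding Fpow_def lower_of_def by blast
  moreover have "\<forall>H\<in>\<H>. \<exists>g\<in>G. (H, {g}) \<in> R" using H(1) lower_of_iff unfolding Fpow_def by blast
  ultimately show ?thesis using H(2) by blast
qed

text \<open>Apply divisibility to all the inner crossing sets simultaneously: the single elements
  chosen for an interpolant meet every crossing set, so by duality they contain some \<open>G \<in> \<G>\<close>.\<close>

lemma divisible_refine:
  assumes div: "divisible S R" and F: "F \<turnstile> \<G>" and G: "\<G> \<in> Fpow (Fpow S)"
  obtains \<H> where "\<H> \<in> Fpow (Fpow S)" "F \<turnstile> \<H>"
    "\<forall>H\<in>\<H>. \<exists>G\<in>\<G>. \<forall>g\<in>G. (H, {g}) \<in> R"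
proof -
  have "\<exists>\<H>\<in>Fpow (Fpow S). F \<turnstile> \<H> \<and> (\<forall>H\<in>\<H>. \<forall>K\<in>inner_cross S \<G>. \<exists>k\<in>K. (H, {k}) \<in> R)"
  proof (rule interpolate_finite)
    show "finite (inner_cross S \<G>)" using inner_cross_Fpow[OF G] by (simp add: Fpow_def)
    show "F \<in> Fpow S" using F by (rule entails_Fpow)
    show "\<exists>\<H>\<in>Fpow (Fpow S). F \<turnstile> \<H> \<and> (\<forall>H\<in>\<H>. \<exists>k\<in>K. (H, {k}) \<in> R)" if "K \<in> inner_cross S \<G>" for K
      using that divisible_single[OF div] F entails_iff_inner_cross[OF G] by blast
    show "\<exists>k\<in>K. (H', {k}) \<in> R" if "\<exists>k\<in>K. (H, {k}) \<in> R" "H \<subseteq> H'" "H' \<in> Fpow S" for H H' K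
      using that R_mono R_carrier by blast
  qed
  then obtain \<H> where H: "\<H> \<in> Fpow (Fpow S)" "F \<turnstile> \<H>"
    "\<forall>H\<in>\<H>. \<forall>K\<in>inner_cross S \<G>. \<exists>k\<in>K. (H, {k}) \<in> R" by blast
  have "\<exists>G\<in>\<G>. \<forall>g\<in>G. (H, {g}) \<in> R" if "H \<in> \<H>" for H
  proof -
    have "{k. (H, {k}) \<in> R} \<inter> K \<noteq> {}" if "K \<in> inner_cross S \<G>" for K
      using H(3) \<open>H \<in> \<H>\<close> that by blast
    from inner_cross_dual[OF G this] show ?thesis by blast
  qed
  thus ?thesis using that H(1,2) by blast
qed

text \<open>The meets of principal quasi-ideals that suffice for \<open>\<Q>\<close> are those indexed by the members of
  \<open>\<Q>\<close> themselves.\<close>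

lemma divisible_generates:
  assumes div: "divisible S R"
  shows "generates L (principal_qi S R ` S)"
  unfolding generates_def
proof (intro conjI ballI)
  fix \<Q> assume "\<Q> \<in> carrier L"
  hence Q: "quasi_ideal S R \<Q>" by (simp add: QI_simps)
  have QS: "\<Q> \<subseteq> Fpow S" using qi_BS[OF Q] BS_subset by blast
  let ?M = "(\<lambda>G. \<Sqinter>\<^bsub>L\<^esub>(principal_qi S R ` G)) ` \<Q>"
  have "?M \<subseteq> {\<Sqinter>\<^bsub>L\<^esub>B |B. B \<in> Fpow (principal_qi S R ` S)}"
  proof
    fix m assume "m \<in> ?M"
    then obtain G where "G \<in> \<Q>" "m = \<Sqinter>\<^bsub>L\<^esub>(principal_qi S R ` G)" by blast
    moreover have "principal_qi S R ` G \<in> Fpow (principal_qi S R ` S)"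
      using QS \<open>G \<in> \<Q>\<close> unfolding Fpow_def by blast
    ultimately show "m \<in> {\<Sqinter>\<^bsub>L\<^esub>B |B. B \<in> Fpow (principal_qi S R ` S)}" by blast
  qed
  moreover have "\<Q> = \<Squnion>\<^bsub>L\<^esub>?M"
  proof -
    have Mc: "?M \<subseteq> carrier L" using Inf_principal_qi QS by (auto simp: QI_simps)
    have "\<Union>?M \<subseteq> \<Q>"
    proof
      fix F assume "F \<in> \<Union>?M"
      then obtain G where G: "G \<in> \<Q>" "F \<in> BS" "\<forall>g\<in>G. (F, {g}) \<in> R"
        using Inf_principal QS by blast
      hence "F \<turnstile> {G}" using entails_singleton BS_subset by blast
      thus "F \<in> \<Q>" using qi_entails[OF Q] G(1) by (auto simp: Fpow_def)
    qed
    from rounding_mono[OF this] have "rounding (\<Union>?M) \<subseteq> \<Q>" using Q by (simp add: quasi_ideal_iff)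
    moreover have "F \<in> rounding (\<Union>?M)" if F: "F \<in> \<Q>" for F
    proof -
      obtain \<G> where G: "F \<turnstile> \<G>" "\<G> \<in> Fpow \<Q>" "\<G> \<in> Fpow (Fpow S)" using qi_obtain[OF Q F] .
      obtain \<H> where H: "\<H> \<in> Fpow (Fpow S)" "F \<turnstile> \<H>"
        "\<forall>H\<in>\<H>. \<exists>G\<in>\<G>. \<forall>g\<in>G. (H, {g}) \<in> R"
        using divisible_refine[OF div G(1,3)] .
      have "H \<in> \<Union>?M" if "H \<in> \<H>" for H
      proof -
        obtain K where K: "K \<in> \<G>" "\<forall>k\<in>K. (H, {k}) \<in> R" using H(3) \<open>H \<in> \<H>\<close> by blast
        have KQ: "K \<in> \<Q>" using K(1) G(2) unfolding Fpow_def by blast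
        have "H \<turnstile> {K}" using entails_singleton K(2) H(1) \<open>H \<in> \<H>\<close> by (auto simp: Fpow_def)
        hence "H \<in> BS" using entails_BS KQ qi_BS[OF Q] by (auto simp: Fpow_def)
        hence "H \<in> \<Sqinter>\<^bsub>L\<^esub>(principal_qi S R ` K)" using Inf_principal KQ QS K(2) by blast
        thus ?thesis using KQ by blast
      qed
      hence "\<H> \<in> Fpow (\<Union>?M)" using H(1) unfolding Fpow_def by blast
      thus ?thesis using H(2) unfolding rounding_def by blast
    qed
    ultimately show ?thesis using Sup_eq[OF Mc] by blast
  qed
  ultimately show "\<exists>M\<subseteq>{\<Sqinter>\<^bsub>L\<^esub>B |B. B \<in> Fpow (principal_qi S R ` S)}. \<Q> = \<Squnion>\<^bsub>L\<^esub>M" by blast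
qed (use principal_carrier in blast)

lemma forcing_carrier: "(F, G) \<in> forcing S R \<Longrightarrow> F \<in> Fpow S \<and> G \<in> Fpow S"
  unfolding forcing_def by blast

lemma forcing_iff:
  assumes "F \<in> Fpow S" "G \<in> Fpow S"
  shows "(F, G) \<in> forcing S R \<longleftrightarrow> \<Sqinter>\<^bsub>L\<^esub>(principal_qi S R ` F) \<subseteq> lower_of S R G"
  using assms Inf_principal lower_of_iff unfolding forcing_def by blast

lemma forcing_mono: "(F, G) \<in> forcing S R \<Longrightarrow> F \<subseteq> F' \<Longrightarrow> F' \<in> Fpow S \<Longrightarrow> (F', G) \<in> forcing S R"
  unfolding forcing_def by blast


section \<open>Auxiliarity\<close>

lemma way_below_lower_of_iff:
  assumes "F \<in> Fpow S" "G \<in> Fpow S"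
  shows "way_below L (\<Sqinter>\<^bsub>L\<^esub>(principal_qi S R ` F)) (lower_of S R G) \<longleftrightarrow>
    (\<exists>\<G>\<in>Fpow (lower_of S R G). \<forall>H\<in>BS. (\<forall>f\<in>F. (H, {f}) \<in> R) \<longrightarrow> H \<turnstile> \<G>)"
  unfolding way_below_iff[OF Inf_principal_qi[OF assms(1)] lower_of_qi[OF assms(2)]]
  by (auto simp: Inf_principal[OF assms(1)])

text \<open>Whatever lies below every \<open>f \<in> F\<close> entails \<open>{F}\<close>, hence every finite family that \<open>F\<close> entails;
  such a family of sets below \<open>G\<close> exists by cut-idempotence.\<close>

lemma R_imp_way_below:
  assumes "(F, G) \<in> R"
  shows "way_below L (\<Sqinter>\<^bsub>L\<^esub>(principal_qi S R ` F)) (lower_of S R G)"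
proof -
  have FG: "F \<in> Fpow S" "G \<in> Fpow S" using assms R_carrier by blast+
  obtain \<G> where G: "F \<turnstile> \<G>" "\<G> \<in> Fpow (lower_of S R G)"
    using qi_obtain[OF lower_of_qi[OF FG(2)]] assms lower_of_iff by blast
  have "H \<turnstile> \<G>" if "H \<in> BS" "\<forall>f\<in>F. (H, {f}) \<in> R" for H
  proof -
    have "H \<turnstile> {F}" using entails_singleton that BS_subset by blast
    thus ?thesis using entails_trans[of H "{F}" \<G>] G(1) by blast
  qed
  thus ?thesis using way_below_lower_of_iff[OF FG] G(2) by blast
qed

text \<open>Cut elimination: auxiliarity removes one forced set \<open>K\<close> at the price of a choice of an
  element of \<open>K\<close>, which is added on the left.  After all the sets of \<open>C\<close> have been treated, the
  left-hand side crosses \<open>C\<close>.\<close>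

lemma auxiliary_cut:
  assumes aux: "auxiliary_to S R (forcing S R)" and G: "G \<in> Fpow S"
  assumes "finite C" "A \<in> Fpow S" "\<And>K. K \<in> C \<Longrightarrow> (A, K) \<in> forcing S R"
    "\<And>B. B \<in> Fpow S \<Longrightarrow> A \<subseteq> B \<Longrightarrow> (\<And>K. K \<in> C \<Longrightarrow> B \<inter> K \<noteq> {}) \<Longrightarrow> (B, G) \<in> R"
  shows "(A, G) \<in> R"
  using assms(3-)
proof (induction C arbitrary: A)
  case empty
  thus ?case by blast
next
  case (insert K C)
  have K: "(A, K) \<in> forcing S R" "K \<in> Fpow S" using insert.prems(2) forcing_carrier by blast+
  have "({k} \<union> A, G) \<in> R" if k: "k \<in> K" for k
  proof (rule insert.IH)
    show A': "{k} \<union> A \<in> Fpow S" using K(2) k insert.prems(1) unfolding Fpow_def by blast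
    show "({k} \<union> A, K') \<in> forcing S R" if "K' \<in> C" for K'
      using forcing_mono[OF insert.prems(2)[of K'] _ A'] that by blast
    show "(B, G) \<in> R"
      if "B \<in> Fpow S" "{k} \<union> A \<subseteq> B" "\<And>K'. K' \<in> C \<Longrightarrow> B \<inter> K' \<noteq> {}" for B
    proof (rule insert.prems(3))
      show "B \<inter> K' \<noteq> {}" if "K' \<in> insert K C" for K'
        using that \<open>{k} \<union> A \<subseteq> B\<close> \<open>\<And>K'. K' \<in> C \<Longrightarrow> B \<inter> K' \<noteq> {}\<close> k by blast
    qed (use that in auto)
  qed
  thus ?case using aux K insert.prems(1) G unfolding auxiliary_to_def by blast
qed

text \<open>The way-below relation supplies a finite family \<open>\<G>\<close> of sets below \<open>G\<close> such that \<open>F\<close> forces all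
  the sets crossing \<open>\<G>\<close>.  A set that meets all of these contains a member of \<open>\<G>\<close> by duality,
  hence is below \<open>G\<close>, so that the cut elimination applies.\<close>

lemma auxiliary_way_below_imp_R:
  assumes aux: "auxiliary_to S R (forcing S R)" and F: "F \<in> Fpow S" and G: "G \<in> Fpow S"
    and wb: "way_below L (\<Sqinter>\<^bsub>L\<^esub>(principal_qi S R ` F)) (lower_of S R G)"
  shows "(F, G) \<in> R"
proof -
  obtain \<G> where \<G>: "\<G> \<in> Fpow (lower_of S R G)"
    and all: "\<And>H. H \<in> BS \<Longrightarrow> \<forall>f\<in>F. (H, {f}) \<in> R \<Longrightarrow> H \<turnstile> \<G>"
    using wb way_below_lower_of_iff[OF F G] by blast
  have FF: "\<G> \<in> Fpow (Fpow S)" using Fpow_BS[OF lower_of_subset_BS \<G>] .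
  show ?thesis
  proof (rule auxiliary_cut[OF aux G])
    show "finite (inner_cross S \<G>)" using inner_cross_Fpow[OF FF] by (simp add: Fpow_def)
    show "F \<in> Fpow S" by fact
    show "(F, K) \<in> forcing S R" if K: "K \<in> inner_cross S \<G>" for K
    proof -
      have "K \<in> Fpow S" using K unfolding inner_cross_def cross_sets_def by blast
      moreover have "(H, K) \<in> R" if "H \<in> BS" "\<forall>f\<in>F. (H, {f}) \<in> R" for H
        using all[OF that] K entails_iff_inner_cross[OF FF] by blast
      ultimately show ?thesis using F unfolding forcing_def by blast
    qed
    show "(B, G) \<in> R"
      if B: "B \<in> Fpow S" "\<And>K. K \<in> inner_cross S \<G> \<Longrightarrow> B \<inter> K \<noteq> {}" for B
    proof -
      obtain G' where "G' \<in> \<G>" "G' \<subseteq> B" using inner_cross_dual[OF FF B(2)] by blast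
      moreover from this have "(G', G) \<in> R" using \<G> lower_of_iff unfolding Fpow_def by blast
      ultimately show ?thesis using R_mono B(1) G by blast
    qed
  qed
qed

text \<open>In the frame of quasi-ideals, forcing \<open>H\<close> makes \<open>\<And>F\<close> the join of the meets
  \<open>\<And>({h} \<union> F)\<close> over \<open>h \<in> H\<close>, by distributivity; each of these finitely many meets is way below
  \<open>\<Or>G\<close>, and hence so is their join.\<close>

lemma way_below_imp_auxiliary:
  assumes div: "divisible S R"
    and wb: "\<And>F G. F \<in> Fpow S \<Longrightarrow> G \<in> Fpow S \<Longrightarrow>
      way_below L (\<Sqinter>\<^bsub>L\<^esub>(principal_qi S R ` F)) (lower_of S R G) \<Longrightarrow> (F, G) \<in> R"
  shows "auxiliary_to S R (forcing S R)"
  unfolding auxiliary_to_def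
proof (intro ballI impI)
  fix F G H
  assume F: "F \<in> Fpow S" and G: "G \<in> Fpow S" and H: "H \<in> Fpow S"
    and FH: "(F, H) \<in> forcing S R" and hFG: "\<forall>h\<in>H. ({h} \<union> F, G) \<in> R"
  have "\<exists>\<G>. \<G> \<in> Fpow (lower_of S R G) \<and> {h} \<union> F \<turnstile> \<G>" if "h \<in> H" for h
  proof -
    have "{h} \<union> F \<in> lower_of S R G" using hFG that lower_of_iff by blast
    from qi_obtain[OF lower_of_qi[OF G] this] show ?thesis by blast
  qed
  then obtain g where g: "\<And>h. h \<in> H \<Longrightarrow> g h \<in> Fpow (lower_of S R G) \<and> {h} \<union> F \<turnstile> g h" by metis
  define \<G> where "\<G> = \<Union>(g ` H)"
  have \<G>: "\<G> \<in> Fpow (lower_of S R G)" using g H unfolding \<G>_def Fpow_def by auto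
  have h\<G>: "{h} \<union> F \<turnstile> \<G>" if "h \<in> H" for h
    using entails_mono[of "{h} \<union> F" "g h" "{h} \<union> F" \<G>] g[OF that] that entails_Fpow
    unfolding \<G>_def by blast
  \<comment> \<open>\<open>K\<close> entails a family \<open>\<L>\<close> of sets below single elements of \<open>H\<close> and a family \<open>\<N>\<close> of sets below
    all elements of \<open>F\<close>; the unions of their members are below \<open>{h} \<union> F\<close> for some \<open>h\<close>.\<close>
  have "K \<turnstile> \<G>" if K: "K \<in> BS" "\<forall>f\<in>F. (K, {f}) \<in> R" for K
  proof -
    have "(K, H) \<in> R" using FH K unfolding forcing_def by blast
    then obtain \<L> where \<L>: "\<L> \<in> Fpow (Fpow S)" "K \<turnstile> \<L>" "\<forall>M\<in>\<L>. \<exists>h\<in>H. (M, {h}) \<in> R"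
      using divisible_single[OF div] by blast
    have FF: "{F} \<in> Fpow (Fpow S)" using F unfolding Fpow_def by simp
    have "K \<turnstile> {F}" using entails_singleton K BS_subset by blast
    then obtain \<N> where \<N>: "\<N> \<in> Fpow (Fpow S)" "K \<turnstile> \<N>" "\<forall>N\<in>\<N>. N \<turnstile> {F}"
      using entails_interpolate[OF _ FF] by metis
    let ?U = "{M \<union> N |M N. M \<in> \<L> \<and> N \<in> \<N>}"
    have "M \<union> N \<turnstile> \<G>" if MN: "M \<in> \<L>" "N \<in> \<N>" for M N
    proof -
      obtain h where h: "h \<in> H" "(M, {h}) \<in> R" using \<L>(3) MN(1) by blast
      have U: "M \<union> N \<in> Fpow S" using MN \<L>(1) \<N>(1) unfolding Fpow_def by blast
      have f: "(N, {f}) \<in> R" if "f \<in> F" for f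
        using entails_singletonD[OF bspec[OF \<N>(3) MN(2)] that] F unfolding Fpow_def by blast
      have "(M \<union> N, {f}) \<in> R" if "f \<in> {h} \<union> F" for f
        using that R_mono[OF h(2) _ order_refl U] R_mono[OF f _ order_refl U] h(2) f R_carrier(2)
        by blast
      hence "M \<union> N \<turnstile> {{h} \<union> F}" using entails_singleton[OF U] by blast
      thus ?thesis using entails_trans[of "M \<union> N" "{{h} \<union> F}" \<G>] h\<G>[OF h(1)] by blast
    qed
    moreover have "finite ?U" using finite_unions \<L>(1) \<N>(1) unfolding Fpow_def by blast
    ultimately show ?thesis using entails_trans[OF entails_meet[OF \<L>(2) \<N>(2)], of \<G>] by blast
  qed
  hence "way_below L (\<Sqinter>\<^bsub>L\<^esub>(principal_qi S R ` F)) (lower_of S R G)"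
    using way_below_lower_of_iff[OF F G] \<G> by blast
  thus "(F, G) \<in> R" using wb F G by blast
qed

lemma divisible_auxiliary_iff:
  assumes "divisible S R"
  shows "auxiliary_to S R (forcing S R) \<longleftrightarrow>
    (\<forall>F\<in>Fpow S. \<forall>G\<in>Fpow S. (F, G) \<in> R \<longleftrightarrow>
      way_below L (\<Sqinter>\<^bsub>L\<^esub>(principal_qi S R ` F)) (lower_of S R G))"
  using R_imp_way_below auxiliary_way_below_imp_R way_below_imp_auxiliary[OF assms] by blast

lemma divisible_strong_idempotent: "divisible S R \<Longrightarrow> strong_idempotent S R"
  using mono idem unfolding strong_idempotent_def cut_idempotent_def by simp

end


section \<open>The lattice of quasi-ideals of a cut-idempotent relation\<close>

theorem theorem3p10:
  fixes S :: "'a set" and R :: "('a set \<times> 'a set) set"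
  assumes rel: "R \<subseteq> Fpow S \<times> Fpow S"
    and mono: "monotone_rel S R"
    and idem: "cut_idempotent S R"
  shows "arithmetic_lattice (QI S R)
    \<and> (\<forall>\<P>\<in>carrier (QI S R). \<forall>\<Q>\<in>carrier (QI S R).
        way_below (QI S R) \<P> \<Q> \<longleftrightarrow>
          (\<exists>\<G>\<in>Fpow \<Q>. \<forall>F\<in>\<P>. \<forall>H\<in>cross_sets S \<G>. (F, H) \<in> R))
    \<and> (divisible S R \<longleftrightarrow>
        (\<forall>G\<in>Fpow S. lower_of S R G = \<Squnion>\<^bsub>QI S R\<^esub>(principal_qi S R ` G)))
    \<and> (divisible S R \<longrightarrow>
        strong_idempotent S R
        \<and> generates (QI S R) (principal_qi S R ` S)
        \<and> (\<forall>F\<in>Fpow S. \<forall>G\<in>Fpow S.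
            (F, G) \<in> forcing S R \<longleftrightarrow>
              \<Sqinter>\<^bsub>QI S R\<^esub>(principal_qi S R ` F) \<subseteq> \<Squnion>\<^bsub>QI S R\<^esub>(principal_qi S R ` G))
        \<and> (auxiliary_to S R (forcing S R) \<longleftrightarrow>
            (\<forall>F\<in>Fpow S. \<forall>G\<in>Fpow S.
              (F, G) \<in> R \<longleftrightarrow>
                way_below (QI S R)
                  (\<Sqinter>\<^bsub>QI S R\<^esub>(principal_qi S R ` F)) (\<Squnion>\<^bsub>QI S R\<^esub>(principal_qi S R ` G))))
        \<and> (auxiliary_to S R (forcing S R) \<longrightarrow> cover_relation S R))"
proof -
  interpret cut_idempotent_relation S R by unfold_locales fact+
  have wb: "way_below L \<P> \<Q> \<longleftrightarrow> (\<exists>\<G>\<in>Fpow \<Q>. \<forall>F\<in>\<P>. \<forall>H\<in>cross_sets S \<G>. (F, H) \<in> R)"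
    if "\<P> \<in> carrier L" "\<Q> \<in> carrier L" for \<P> \<Q>
  proof -
    have q: "quasi_ideal S R \<P>" "quasi_ideal S R \<Q>" using that by (simp_all add: QI_simps)
    hence "\<P> \<subseteq> Fpow S" using qi_BS BS_subset by blast
    thus ?thesis using way_below_iff[OF q] unfolding entails_def by blast
  qed
  show ?thesis
  proof (intro conjI impI)
    show "divisible S R \<longleftrightarrow>
        (\<forall>G\<in>Fpow S. lower_of S R G = \<Squnion>\<^bsub>L\<^esub>(principal_qi S R ` G))"
      by (rule divisible_iff_lower_of)
    assume div: "divisible S R"
    have join: "\<Squnion>\<^bsub>L\<^esub>(principal_qi S R ` G) = lower_of S R G" if "G \<in> Fpow S" for G
      using div that divisible_iff_lower_of by simp
    show "\<forall>F\<in>Fpow S. \<forall>G\<in>Fpow S. (F, G) \<in> forcing S R \<longleftrightarrow>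
        \<Sqinter>\<^bsub>L\<^esub>(principal_qi S R ` F) \<subseteq> \<Squnion>\<^bsub>L\<^esub>(principal_qi S R ` G)"
      using forcing_iff join by simp
    show "auxiliary_to S R (forcing S R) \<longleftrightarrow>
        (\<forall>F\<in>Fpow S. \<forall>G\<in>Fpow S. (F, G) \<in> R \<longleftrightarrow>
          way_below L (\<Sqinter>\<^bsub>L\<^esub>(principal_qi S R ` F)) (\<Squnion>\<^bsub>L\<^esub>(principal_qi S R ` G)))"
      using divisible_auxiliary_iff[OF div] join by simp
    show "strong_idempotent S R" using divisible_strong_idempotent[OF div] .
    thus "cover_relation S R" if "auxiliary_to S R (forcing S R)"
      using that unfolding cover_relation_def by blast
    show "generates L (principal_qi S R ` S)" using divisible_generates[OF div] .
  qed (use QI_arithmetic_lattice wb in auto)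
qed

end
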